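(* Let $X$ be a connected Hausdorff topological space, let $G$ be a compact Hausdorff topological group with identity $e$, and let $p:X\to G$ be a finite-sheeted covering mapping. Then for any point $\widetilde e\in p^{-1}(e)$ there exists a unique structure of topological group on the topological space $X$ (compatible with its given topology) such that $\widetilde e$ is the identity and $p:X\to G$ is a homomorphism of compact groups. Furthermore, if $G$ is abelian, then $p$ is a homomorphism of abelian groups (that is, $X$ with this structure is abelian as well).
   Context: A continuous surjection $p:X\to Y$ between topological spaces is a $k$-fold (or $k$-sheeted) covering mapping, $k\in\mathbb N=\{1,2,\dots\}$, if every $y\in Y$ has an open neighborhood $W$ such that $p^{-1}(W)$ is a disjoint union of $k$ open sets $V_1,\dots,V_k$ of $X$, each mapped homeomorphically onto $W$ by $p$. It is finite-sheeted if it is $k$-fold for some $k\in\mathbb N$. Homomorphisms of topological groups are continuous. No local connectedness of $G$ or $X$ is assumed. *)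

theory Defs
  imports "HOL-Algebra.Group" "HOL-Analysis.Analysis"
begin

locale topological_group = group G for G (structure) +
  fixes T :: "'a topology"
  assumes carrier_eq_topspace: "carrier G = topspace T"
    and continuous_mult: "continuous_map (prod_topology T T) T (\<lambda>(x, y). x \<otimes> y)"
    and continuous_inv: "continuous_map T T (\<lambda>x. inv x)"

locale compact_group = topological_group G T for G (structure) and T +
  assumes compact: "compact_space T"
    and Hausdorff: "Hausdorff_space T"

locale compact_group_hom =
  source: compact_group G S + target: compact_group H T
  for G (structure) and S and H (structure) and T +
  fixes h
  assumes hom: "h \<in> hom G H"
    and continuous: "continuous_map S T h"

definition sheeted_covering_map ::
    "nat \<Rightarrow> 'a topology \<Rightarrow> 'b topology \<Rightarrow> ('a \<Rightarrow> 'b) \<Rightarrow> bool" where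
  "sheeted_covering_map k X Y p \<longleftrightarrow>
     continuous_map X Y p \<and> p ` topspace X = topspace Y \<and>
     (\<forall>y \<in> topspace Y. \<exists>W. openin Y W \<and> y \<in> W \<and>
        (\<exists>V. (\<Union>i\<in>{1..k}. V i) = {x \<in> topspace X. p x \<in> W} \<and>
             disjoint_family_on V {1..k} \<and>
             (\<forall>i\<in>{1..k}. openin X (V i) \<and>
                homeomorphic_map (subtopology X (V i)) (subtopology Y W) p)))"

definition finite_sheeted_covering_map ::
    "'a topology \<Rightarrow> 'b topology \<Rightarrow> ('a \<Rightarrow> 'b) \<Rightarrow> bool" where
  "finite_sheeted_covering_map X Y p \<longleftrightarrow> (\<exists>k\<ge>1. sheeted_covering_map k X Y p)"

(* Only the values of the operations on the carrier matter: records agreeing there are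
   the same group structure, although they may be unequal as records. The inverse is
   determined by the multiplication. *)
definition same_group_structure :: "'a monoid \<Rightarrow> 'a monoid \<Rightarrow> bool" where
  "same_group_structure H K \<longleftrightarrow>
     carrier H = carrier K \<and> \<one>\<^bsub>H\<^esub> = \<one>\<^bsub>K\<^esub> \<and>
     (\<forall>x\<in>carrier H. \<forall>y\<in>carrier H. x \<otimes>\<^bsub>H\<^esub> y = x \<otimes>\<^bsub>K\<^esub> y)"

end

theory Submission
  imports Defs
begin

text \<open>
  The group \<open>X\<close> is found as a group of homeomorphisms of itself: if a group structure exists at
  all, its right translations are continuous maps \<open>f : X \<rightarrow> X\<close> covering right translations
  of \<open>G\<close>, that is, \<open>p (f x) = p x \<otimes> a\<close> for a constant \<open>a\<close>.  Call every such map a translation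
  lift; the translation lifts form a monoid under composition.  The point is that they act
  simply transitively on \<open>X\<close>, so that \<open>x \<cdot> y := f\<^sub>y x\<close>, where \<open>f\<^sub>y\<close> is the one with \<open>f\<^sub>y e = y\<close>,
  is a group multiplication.

  Freeness (\<open>translation_lift_unique\<close>) is unique lifting: two maps from a connected space that
  cover the same map and agree at one point are equal, because \<open>p\<close> is locally injective and
  \<open>X\<close> is Hausdorff.

  Transitivity (\<open>translation_lifts_transitive\<close>) needs a supply of translation lifts.  Path
  lifting is not available since \<open>X\<close> and \<open>G\<close> need not be locally connected, and compactness
  replaces it.  There is a neighbourhood \<open>E\<close> of the diagonal of \<open>X\<close> such that no two distinct
  points of one fibre are \<open>E\<close>-close to a common point
  (\<open>separating_neighbourhood_of_diagonal\<close>).  For \<open>u\<close> in a small neighbourhood \<open>U\<close> of \<open>\<one>\<close>, not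
  depending on \<open>x\<close>, some point over \<open>p x \<otimes> u\<close> is \<open>E\<close>-close to \<open>x\<close>; it is then the only one,
  and \<open>\<phi> u x\<close> denotes it.  The resulting map is jointly continuous
  (\<open>local_translation_action\<close>), so each \<open>\<phi> u\<close> is a translation lift, and these move every
  point to all sufficiently near ones.  Hence the orbits are open, and as \<open>X\<close> is connected
  there is only one.

  The multiplication and the inverse are continuous because \<open>f\<^sub>y = \<phi> (inv (p z) \<otimes> p y) \<circ> f\<^sub>z\<close>
  for \<open>y\<close> near \<open>z\<close>.  Uniqueness of the structure and commutativity are again unique lifting,
  now on the connected space \<open>X \<times> X\<close>: two multiplications covering the same map to \<open>G\<close> and
  agreeing at \<open>(e, e)\<close> coincide.

  The covering enters through three of its properties: \<open>p\<close> is open and locally injective, and,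
  the fibres being finite, \<open>X\<close> inherits compactness from \<open>G\<close>.
\<close>

section \<open>Unique lifting along locally injective maps\<close>

definition locally_injective_map :: "'a topology \<Rightarrow> ('a \<Rightarrow> 'b) \<Rightarrow> bool" where
  "locally_injective_map X p \<longleftrightarrow> (\<forall>x\<in>topspace X. \<exists>N. openin X N \<and> x \<in> N \<and> inj_on p N)"

text \<open>The set where \<open>f\<close> and \<open>g\<close> agree is closed since \<open>X\<close> is Hausdorff, and open since both maps
  send a neighbourhood of an agreement point into a set on which \<open>p\<close> is injective.\<close>

lemma lifts_agree:
  assumes Z: "connected_space Z" and X: "Hausdorff_space X"
    and p: "locally_injective_map X p"
    and f: "continuous_map Z X f" and g: "continuous_map Z X g"
    and same: "\<And>z. z \<in> topspace Z \<Longrightarrow> p (f z) = p (g z)"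
    and z0: "z0 \<in> topspace Z" "f z0 = g z0" and z: "z \<in> topspace Z"
  shows "f z = g z"
proof -
  let ?A = "{z \<in> topspace Z. f z = g z}"
  have "openin Z ?A"
    unfolding openin_subopen[of Z ?A]
  proof
    fix a assume a: "a \<in> ?A"
    have "f a \<in> topspace X"
      using a f by (blast dest: continuous_map_funspace)
    then obtain N where N: "openin X N" "f a \<in> N" "inj_on p N"
      using p by (auto simp: locally_injective_map_def)
    let ?B = "{z \<in> topspace Z. f z \<in> N} \<inter> {z \<in> topspace Z. g z \<in> N}"
    have "openin Z ?B"
      using openin_continuous_map_preimage[OF f N(1)] openin_continuous_map_preimage[OF g N(1)]
      by blast
    moreover have "a \<in> ?B" using a N by auto
    moreover have "?B \<subseteq> ?A" using same N(3) by (auto dest: inj_onD)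
    ultimately show "\<exists>B. openin Z B \<and> a \<in> B \<and> B \<subseteq> ?A" by blast
  qed
  moreover have "closedin Z ?A" by (rule closedin_continuous_maps_eq[OF X f g])
  ultimately have "?A = {} \<or> ?A = topspace Z"
    using Z by (auto simp: connected_space_clopen_in)
  then show ?thesis using z0 z by blast
qed

lemma continuous_map_locally:
  assumes "\<And>x. x \<in> topspace X \<Longrightarrow>
             \<exists>N. openin X N \<and> x \<in> N \<and> continuous_map (subtopology X N) Y f"
  shows "continuous_map X Y f"
proof -
  obtain N where N: "\<And>x. x \<in> topspace X \<Longrightarrow>
      openin X (N x) \<and> x \<in> N x \<and> continuous_map (subtopology X (N x)) Y f"
    using assms by metis
  show ?thesis
    by (rule pasting_lemma[where I = "topspace X" and T = N and f = "\<lambda>_. f"]) (use N in auto)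
qed

section \<open>Finite-sheeted coverings\<close>

lemma compact_space_finite_neighbourhood_cover:
  assumes X: "compact_space X" and W: "\<And>x. x \<in> topspace X \<Longrightarrow> openin X (W x) \<and> x \<in> W x"
  obtains F where "finite F" "F \<subseteq> topspace X" "topspace X \<subseteq> \<Union>(W ` F)"
proof -
  have "\<forall>U\<in>W ` topspace X. openin X U" "topspace X \<subseteq> \<Union>(W ` topspace X)"
    using W by blast+
  then obtain \<G> where \<G>: "finite \<G>" "\<G> \<subseteq> W ` topspace X" "topspace X \<subseteq> \<Union>\<G>"
    using X unfolding compact_space_alt by meson
  obtain F where "F \<subseteq> topspace X" "finite F" "\<G> = W ` F"
    using finite_subset_image[OF \<G>(1,2)] by blast
  then show thesis using that \<G>(3) by blast
qed

text \<open>The sheet through \<open>x\<close> over an evenly covered neighbourhood of \<open>p x\<close>.\<close>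

lemma sheet_at:
  assumes cov: "sheeted_covering_map k X Y p" and x: "x \<in> topspace X"
  obtains V where "openin X V" "x \<in> V" "inj_on p V" "open_map (subtopology X V) Y p"
proof -
  have "p x \<in> topspace Y" using cov x by (auto simp: sheeted_covering_map_def)
  then obtain W V where W: "openin Y W" "p x \<in> W"
    and V: "(\<Union>i\<in>{1..k}. V i) = {x \<in> topspace X. p x \<in> W}"
    and Vi: "\<And>i. i \<in> {1..k} \<Longrightarrow> openin X (V i) \<and>
               homeomorphic_map (subtopology X (V i)) (subtopology Y W) p"
    using cov unfolding sheeted_covering_map_def by meson
  have "x \<in> (\<Union>i\<in>{1..k}. V i)" using V x W(2) by blast
  then obtain i where i: "i \<in> {1..k}" "x \<in> V i" by blast
  have h: "homeomorphic_map (subtopology X (V i)) (subtopology Y W) p" and o: "openin X (V i)"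
    using Vi i by auto
  show thesis
  proof
    show "inj_on p (V i)"
      using homeomorphic_imp_injective_map[OF h] o
      by (metis inf.absorb_iff2 openin_subset topspace_subtopology)
    show "open_map (subtopology X (V i)) Y p"
      using homeomorphic_imp_open_map[OF h] W(1)
      by (metis open_map_in_subtopology open_map_into_subtopology open_map_def openin_trans_full)
  qed (use o i in auto)
qed

lemma sheeted_covering_imp_locally_injective:
  assumes "sheeted_covering_map k X Y p"
  shows "locally_injective_map X p"
  unfolding locally_injective_map_def using sheet_at[OF assms] by metis

lemma sheeted_covering_imp_open_map:
  assumes cov: "sheeted_covering_map k X Y p"
  shows "open_map X Y p"
  unfolding open_map_def
proof (intro allI impI)
  fix S assume S: "openin X S"
  show "openin Y (p ` S)"
    unfolding openin_subopen[of Y "p ` S"]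
  proof
    fix y assume "y \<in> p ` S"
    then obtain x where x: "x \<in> S" "y = p x" by blast
    then have "x \<in> topspace X" using S openin_subset by blast
    then obtain V where V: "openin X V" "x \<in> V" "open_map (subtopology X V) Y p"
      using sheet_at[OF cov] by metis
    have "openin (subtopology X V) (V \<inter> S)"
      using S by (simp add: openin_subtopology_Int2)
    then have "openin Y (p ` (V \<inter> S))" using V(3) by (auto simp: open_map_def)
    then show "\<exists>B. openin Y B \<and> y \<in> B \<and> B \<subseteq> p ` S" using x V(2) by blast
  qed
qed

text \<open>Each fibre is finite, so finitely many members of an open cover of \<open>X\<close> contain it.  Intersecting
  the images of their traces on the sheets gives a neighbourhood \<open>W\<close> of the point below whose whole
  preimage they still cover; then finitely many such \<open>W\<close> cover the base.\<close>

lemma sheeted_covering_compact_space: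
  assumes cov: "sheeted_covering_map k X Y p" and Y: "compact_space Y"
  shows "compact_space X"
  unfolding compact_space_alt
proof (intro allI impI)
  fix \<U> assume "(\<forall>U\<in>\<U>. openin X U) \<and> topspace X \<subseteq> \<Union>\<U>"
  then have \<U>: "\<forall>U\<in>\<U>. openin X U" "topspace X \<subseteq> \<Union>\<U>" by auto
  have p: "continuous_map X Y p" using cov by (simp add: sheeted_covering_map_def)
  have open_p: "open_map X Y p" by (rule sheeted_covering_imp_open_map[OF cov])
  have "\<exists>W \<F>. openin Y W \<and> y \<in> W \<and> finite \<F> \<and> \<F> \<subseteq> \<U> \<and> {x \<in> topspace X. p x \<in> W} \<subseteq> \<Union>\<F>"
    if y: "y \<in> topspace Y" for y
  proof -
    obtain W V where W: "openin Y W" "y \<in> W"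
      and V: "(\<Union>i\<in>{1..k}. V i) = {x \<in> topspace X. p x \<in> W}"
      and Vi: "\<And>i. i \<in> {1..k} \<Longrightarrow> openin X (V i) \<and>
                 homeomorphic_map (subtopology X (V i)) (subtopology Y W) p"
      using cov y unfolding sheeted_covering_map_def by meson
    have img: "p ` V i = W" and inj: "inj_on p (V i)" if "i \<in> {1..k}" for i
    proof -
      have "topspace (subtopology X (V i)) = V i" "topspace (subtopology Y W) = W"
        using Vi[OF that] W(1) by (auto dest: openin_subset)
      then show "p ` V i = W" "inj_on p (V i)"
        using Vi[OF that] homeomorphic_imp_surjective_map homeomorphic_imp_injective_map by metis+
    qed
    have "\<exists>x. x \<in> V i \<and> p x = y" if "i \<in> {1..k}" for i
      using img[OF that] W(2) by blast
    then obtain x where x: "\<And>i. i \<in> {1..k} \<Longrightarrow> x i \<in> V i \<and> p (x i) = y" by metis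
    have "\<exists>U\<in>\<U>. x i \<in> U" if "i \<in> {1..k}" for i
      using x[OF that] Vi[OF that] \<U>(2) openin_subset by blast
    then obtain U where U: "\<And>i. i \<in> {1..k} \<Longrightarrow> U i \<in> \<U> \<and> x i \<in> U i" by metis
    \<comment> \<open>Over \<open>?W\<close>, the sheet \<open>V i\<close> lies entirely in \<open>U i\<close>.\<close>
    let ?W = "W \<inter> ((\<Inter>i\<in>{1..k}. p ` (V i \<inter> U i)) \<inter> topspace Y)"
    have "openin Y (p ` (V i \<inter> U i))" if "i \<in> {1..k}" for i
      using open_p Vi[OF that] U[OF that] \<U>(1) by (auto simp: open_map_def)
    then have "openin Y ?W" using W(1) by (intro openin_Int[OF W(1)] openin_INT) auto
    moreover have "y \<in> ?W"
    proof -
      have "y \<in> p ` (V i \<inter> U i)" if "i \<in> {1..k}" for i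
        using x[OF that] U[OF that] by (intro image_eqI[of _ _ "x i"]) auto
      then show ?thesis using W y by blast
    qed
    moreover have "{x \<in> topspace X. p x \<in> ?W} \<subseteq> \<Union>(U ` {1..k})"
    proof
      fix z assume z: "z \<in> {x \<in> topspace X. p x \<in> ?W}"
      then have "z \<in> (\<Union>i\<in>{1..k}. V i)" using V by blast
      then obtain i where i: "i \<in> {1..k}" "z \<in> V i" by blast
      then have "p z \<in> p ` (V i \<inter> U i)" using z by blast
      then have "z \<in> U i" using inj[OF i(1)] i(2) by (auto dest: inj_onD)
      then show "z \<in> \<Union>(U ` {1..k})" using i by blast
    qed
    ultimately show ?thesis
      using U by (intro exI[of _ ?W] exI[of _ "U ` {1..k}"]) auto
  qed
  then obtain W \<F> where W: "\<And>y. y \<in> topspace Y \<Longrightarrow> openin Y (W y) \<and> y \<in> W y \<and>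
      finite (\<F> y) \<and> \<F> y \<subseteq> \<U> \<and> {x \<in> topspace X. p x \<in> W y} \<subseteq> \<Union>(\<F> y)"
    by metis
  obtain F where F: "finite F" "F \<subseteq> topspace Y" "topspace Y \<subseteq> \<Union>(W ` F)"
    using compact_space_finite_neighbourhood_cover[OF Y, of W] W by blast
  have "topspace X \<subseteq> \<Union>(\<Union>(\<F> ` F))"
  proof
    fix x assume x: "x \<in> topspace X"
    then have "p x \<in> topspace Y" using p by (auto simp: continuous_map_def)
    then obtain y where "y \<in> F" "p x \<in> W y" using F by blast
    then show "x \<in> \<Union>(\<Union>(\<F> ` F))" using W[of y] F x by blast
  qed
  moreover have "finite (\<Union>(\<F> ` F))" "\<Union>(\<F> ` F) \<subseteq> \<U>" using F W by auto
  ultimately show "\<exists>\<F>. finite \<F> \<and> \<F> \<subseteq> \<U> \<and> topspace X \<subseteq> \<Union>\<F>" by blast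
qed

section \<open>Small translations of the base lift canonically\<close>

lemma (in topological_group) continuous_map_mult:
  assumes "continuous_map Z T f" "continuous_map Z T g"
  shows "continuous_map Z T (\<lambda>z. f z \<otimes> g z)"
  using continuous_map_compose[OF continuous_map_pairedI[OF assms] continuous_mult]
  by (simp add: o_def)

lemma (in topological_group) continuous_map_inverse:
  assumes "continuous_map Z T f"
  shows "continuous_map Z T (\<lambda>z. inv f z)"
  using continuous_map_compose[OF assms continuous_inv] by (simp add: o_def)

text \<open>This is a Lebesgue number argument.  Cover \<open>X\<close> by finitely many closed sets \<open>C i\<close>, each inside an
  open set \<open>P i\<close> on which \<open>p\<close> is injective, and call \<open>y\<close> close to \<open>x\<close> if \<open>y \<in> P i\<close> whenever
  \<open>x \<in> C i\<close>.  Two points close to \<open>x\<close> share some \<open>P i\<close>, so \<open>p\<close> tells them apart.\<close>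

lemma separating_neighbourhood_of_diagonal:
  assumes X: "compact_space X" "Hausdorff_space X" and p: "locally_injective_map X p"
  obtains E where "openin (prod_topology X X) E" "\<And>x. x \<in> topspace X \<Longrightarrow> (x, x) \<in> E"
    "\<And>x y z. \<lbrakk>(x, y) \<in> E; (x, z) \<in> E; p y = p z\<rbrakk> \<Longrightarrow> y = z"
proof -
  have nb: "\<exists>Q C P. openin X Q \<and> closedin X C \<and> openin X P \<and> inj_on p P \<and>
      x \<in> Q \<and> Q \<subseteq> C \<and> C \<subseteq> P" if "x \<in> topspace X" for x
  proof -
    obtain P where P: "openin X P" "x \<in> P" "inj_on p P"
      using p \<open>x \<in> topspace X\<close> unfolding locally_injective_map_def by blast
    have "neighbourhood_base_of (closedin X) X"
      using compact_Hausdorff_imp_regular_space[OF X] by (simp add: neighbourhood_base_of_closedin)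
    then show ?thesis using P unfolding neighbourhood_base_of by meson
  qed
  then obtain Q C P where QCP: "\<And>x. x \<in> topspace X \<Longrightarrow>
      openin X (Q x) \<and> closedin X (C x) \<and> openin X (P x) \<and> inj_on p (P x) \<and>
      x \<in> Q x \<and> Q x \<subseteq> C x \<and> C x \<subseteq> P x"
    by metis
  obtain F where F: "finite F" "F \<subseteq> topspace X" "topspace X \<subseteq> \<Union>(Q ` F)"
    using compact_space_finite_neighbourhood_cover[OF X(1), of Q] QCP by blast
  let ?B = "\<Union>i\<in>F. C i \<times> (topspace X - P i)"
  let ?E = "topspace (prod_topology X X) - ?B"
  have "closedin (prod_topology X X) (C i \<times> (topspace X - P i))" if "i \<in> F" for i
    using that F(2) QCP[of i] by (auto simp: closedin_prod_Times_iff intro!: closedin_diff)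
  then have "closedin (prod_topology X X) ?B"
    using F(1) by (intro closedin_Union) auto
  then have "openin (prod_topology X X) ?E" by blast
  moreover have "(x, x) \<in> ?E" if "x \<in> topspace X" for x
    using that F(2) QCP by auto
  moreover have "y = z" if "(x, y) \<in> ?E" "(x, z) \<in> ?E" "p y = p z" for x y z
  proof -
    have "x \<in> topspace X" using that by simp
    then obtain i where i: "i \<in> F" "x \<in> Q i" using F(3) by blast
    have i': "i \<in> topspace X" using i(1) F(2) by blast
    then have "x \<in> C i" using i(2) QCP by blast
    then have "y \<in> P i" "z \<in> P i" using that i(1) by auto
    then show ?thesis using QCP[OF i'] that(3) by (auto dest: inj_onD)
  qed
  ultimately show thesis by (rule that)
qed

text \<open>The properties of a pointed finite-sheeted covering of \<open>G\<close> on which the construction rests.\<close>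

locale local_cover_of_compact_group = compact_group G T for G (structure) and T +
  fixes X :: "'c topology" and p :: "'c \<Rightarrow> 'a" and e :: 'c
  assumes compact_X: "compact_space X" and Hausdorff_X: "Hausdorff_space X"
    and connected_X: "connected_space X"
    and continuous_p: "continuous_map X T p" and open_p: "open_map X T p"
    and locally_injective_p: "locally_injective_map X p"
    and e_in: "e \<in> topspace X" and p_e: "p e = \<one>"
begin

lemma p_closed [simp]: "x \<in> topspace X \<Longrightarrow> p x \<in> carrier G"
  using continuous_p carrier_eq_topspace by (auto simp: continuous_map_def)

text \<open>Near a point \<open>x\<close> this holds because \<open>p\<close> is open: if \<open>N1 \<times> N2 \<subseteq> E\<close> is a neighbourhood of \<open>(x, x)\<close>,
  the products \<open>p z \<otimes> u\<close> with \<open>z\<close> near \<open>x\<close> and \<open>u\<close> near \<open>\<one>\<close> stay in the open set \<open>p ` N2\<close>.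
  Compactness of \<open>X\<close> makes \<open>U\<close> independent of \<open>x\<close>.\<close>

lemma short_translations_lift:
  assumes E: "openin (prod_topology X X) E" and diag: "\<And>x. x \<in> topspace X \<Longrightarrow> (x, x) \<in> E"
  obtains U where "openin T U" "\<one> \<in> U"
    "\<And>x u. \<lbrakk>x \<in> topspace X; u \<in> U\<rbrakk> \<Longrightarrow> \<exists>y. (x, y) \<in> E \<and> p y = p x \<otimes> u"
proof -
  have "\<exists>M U. openin X M \<and> x \<in> M \<and> openin T U \<and> \<one> \<in> U \<and>
      (\<forall>z\<in>M. \<forall>u\<in>U. \<exists>y. (z, y) \<in> E \<and> p y = p z \<otimes> u)" if x: "x \<in> topspace X" for x
  proof -
    obtain N1 N2 where N: "openin X N1" "openin X N2" "x \<in> N1" "x \<in> N2" "N1 \<times> N2 \<subseteq> E"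
      using E diag[OF x] unfolding openin_prod_topology_alt by meson
    let ?P = "{z \<in> topspace (prod_topology X T). p (fst z) \<otimes> snd z \<in> p ` N2}"
    have "openin T (p ` N2)" using open_p N(2) by (auto simp: open_map_def)
    moreover have "continuous_map (prod_topology X T) T (\<lambda>z. p (fst z) \<otimes> snd z)"
      using continuous_map_compose[OF continuous_map_fst continuous_p]
      by (intro continuous_map_mult) (auto simp: o_def continuous_map_snd)
    ultimately have "openin (prod_topology X T) ?P"
      by (rule openin_continuous_map_preimage[rotated])
    moreover have "(x, \<one>) \<in> ?P" using x N(4) carrier_eq_topspace by auto
    ultimately obtain M U where M: "openin X M" "openin T U" "x \<in> M" "\<one> \<in> U" "M \<times> U \<subseteq> ?P"
      unfolding openin_prod_topology_alt by meson
    have "\<exists>y. (z, y) \<in> E \<and> p y = p z \<otimes> u" if z: "z \<in> M \<inter> N1" and u: "u \<in> U" for z u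
    proof -
      have "(z, u) \<in> ?P" using z u M(5) by blast
      then have "p z \<otimes> u \<in> p ` N2" by simp
      then obtain y where "y \<in> N2" "p z \<otimes> u = p y" by blast
      then show ?thesis using z N(5) by (intro exI[of _ y]) auto
    qed
    moreover have "openin X (M \<inter> N1)" using M N by blast
    ultimately show ?thesis
      using M N by (intro exI[of _ "M \<inter> N1"] exI[of _ U]) auto
  qed
  then obtain M U where MU: "\<And>x. x \<in> topspace X \<Longrightarrow> openin X (M x) \<and> x \<in> M x \<and>
      openin T (U x) \<and> \<one> \<in> U x \<and> (\<forall>z\<in>M x. \<forall>u\<in>U x. \<exists>y. (z, y) \<in> E \<and> p y = p z \<otimes> u)"
    by metis
  obtain F where F: "finite F" "F \<subseteq> topspace X" "topspace X \<subseteq> \<Union>(M ` F)"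
    using compact_space_finite_neighbourhood_cover[OF compact_X, of M] MU by blast
  show thesis
  proof
    show "openin T ((\<Inter>i\<in>F. U i) \<inter> topspace T)"
      using F MU by (intro openin_INT) auto
    show "\<one> \<in> (\<Inter>i\<in>F. U i) \<inter> topspace T"
      using F MU carrier_eq_topspace by auto
    show "\<exists>y. (x, y) \<in> E \<and> p y = p x \<otimes> u"
      if xu: "x \<in> topspace X" "u \<in> (\<Inter>i\<in>F. U i) \<inter> topspace T" for x u
    proof -
      obtain i where i: "i \<in> F" "x \<in> M i" using xu(1) F by blast
      then have "u \<in> U i" using xu(2) by blast
      then show ?thesis using i F(2) MU[of i] by blast
    qed
  qed
qed

text \<open>With \<open>E\<close> as a measure of closeness, \<open>\<phi> u x\<close> is the unique point over \<open>p x \<otimes> u\<close> that is close to \<open>x\<close>.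
  The last property says that \<open>\<phi>\<close> carries any point to
  any sufficiently near one, which is what makes the orbits of translation lifts open.\<close>

lemma local_translation_action:
  obtains U \<phi> where "openin T U"
    "continuous_map (prod_topology (subtopology T U) X) X (\<lambda>(u, x). \<phi> u x)"
    "\<And>u x. \<lbrakk>u \<in> U; x \<in> topspace X\<rbrakk> \<Longrightarrow> p (\<phi> u x) = p x \<otimes> u"
    "\<And>x. x \<in> topspace X \<Longrightarrow> \<exists>N. openin X N \<and> x \<in> N \<and>
       (\<forall>y\<in>N. \<forall>z\<in>N. inv (p y) \<otimes> p z \<in> U \<and> \<phi> (inv (p y) \<otimes> p z) y = z)"
proof -
  obtain E where E: "openin (prod_topology X X) E" "\<And>x. x \<in> topspace X \<Longrightarrow> (x, x) \<in> E"
    and sep: "\<And>x y z. \<lbrakk>(x, y) \<in> E; (x, z) \<in> E; p y = p z\<rbrakk> \<Longrightarrow> y = z"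
    using separating_neighbourhood_of_diagonal[OF compact_X Hausdorff_X locally_injective_p]
    by metis
  obtain U where U: "openin T U" "\<one> \<in> U"
    and ex: "\<And>x u. \<lbrakk>x \<in> topspace X; u \<in> U\<rbrakk> \<Longrightarrow> \<exists>y. (x, y) \<in> E \<and> p y = p x \<otimes> u"
    using short_translations_lift[OF E] by metis
  have EX: "y \<in> topspace X" "x \<in> topspace X" if "(x, y) \<in> E" for x y
    using openin_subset[OF E(1)] that by auto
  have UG: "u \<in> carrier G" if "u \<in> U" for u
    using openin_subset[OF U(1)] that carrier_eq_topspace by auto
  define \<phi> where "\<phi> u x = (SOME y. (x, y) \<in> E \<and> p y = p x \<otimes> u)" for u x
  have \<phi>: "(x, \<phi> u x) \<in> E" "p (\<phi> u x) = p x \<otimes> u" if "x \<in> topspace X" "u \<in> U" for x u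
    using someI_ex[OF ex[OF that]] by (simp_all add: \<phi>_def)
  have \<phi>_eq: "\<phi> u x = y" if "(x, y) \<in> E" "u \<in> U" "p y = p x \<otimes> u" for x y u
    using sep \<phi> EX that by metis
  show thesis
  proof
    show "openin T U" by fact
    show "p (\<phi> u x) = p x \<otimes> u" if "u \<in> U" "x \<in> topspace X" for u x
      using \<phi> that by blast
    let ?Z = "prod_topology (subtopology T U) X"
    have Z: "topspace ?Z = U \<times> topspace X"
      using openin_subset[OF U(1)] by auto
    show "continuous_map ?Z X (\<lambda>(u, x). \<phi> u x)"
      unfolding continuous_map_def
    proof (intro conjI allI impI)
      show "(\<lambda>(u, x). \<phi> u x) \<in> topspace ?Z \<rightarrow> topspace X"
        unfolding Z using EX(1)[OF \<phi>(1)] by auto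
      fix V assume V: "openin X V"
      let ?A = "{z \<in> topspace ?Z. (case z of (u, x) \<Rightarrow> \<phi> u x) \<in> V}"
      show "openin ?Z ?A"
        unfolding openin_subopen[of ?Z ?A]
      proof
        fix z assume "z \<in> ?A"
        then obtain u x where z: "z = (u, x)" "u \<in> U" "x \<in> topspace X" "\<phi> u x \<in> V"
          unfolding Z by auto
        obtain N1 N2 where N: "openin X N1" "openin X N2" "x \<in> N1" "\<phi> u x \<in> N2" "N1 \<times> N2 \<subseteq> E"
          using E(1) \<phi>(1)[OF z(3,2)] unfolding openin_prod_topology_alt by meson
        \<comment> \<open>Near \<open>(u, x)\<close> there is a point of \<open>?V\<close> over the translated point that is close to the
          point translated; by uniqueness it is the value of \<open>\<phi>\<close>.\<close>
        let ?V = "V \<inter> N2"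
        let ?P = "{z \<in> topspace ?Z. p (snd z) \<otimes> fst z \<in> p ` ?V}"
        let ?B = "?P \<inter> {z \<in> topspace ?Z. snd z \<in> N1}"
        have "openin T (p ` ?V)" using open_p N(2) V by (auto simp: open_map_def)
        moreover have "continuous_map ?Z T (\<lambda>z. p (snd z) \<otimes> fst z)"
          using continuous_map_compose[OF continuous_map_snd continuous_p]
            continuous_map_into_fulltopology[OF continuous_map_fst]
          by (intro continuous_map_mult) (auto simp: o_def)
        ultimately have "openin ?Z ?P"
          by (rule openin_continuous_map_preimage[rotated])
        moreover have "openin ?Z {z \<in> topspace ?Z. snd z \<in> N1}"
          by (rule openin_continuous_map_preimage[OF continuous_map_snd N(1)])
        ultimately have "openin ?Z ?B" by (rule openin_Int)
        moreover have "z \<in> ?B"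
          unfolding Z using z N \<phi>(2)[OF z(3,2)] by (auto intro!: image_eqI[of _ _ "\<phi> u x"])
        moreover have "?B \<subseteq> ?A"
        proof
          fix w assume w: "w \<in> ?B"
          obtain v y where wv: "w = (v, y)" by (cases w)
          have v: "v \<in> U" "y \<in> topspace X" "y \<in> N1" using w unfolding wv Z by auto
          have "p y \<otimes> v \<in> p ` ?V" using w wv by simp
          then obtain y' where y': "y' \<in> V" "y' \<in> N2" "p y \<otimes> v = p y'" by blast
          have "\<phi> v y = y'" using y' v N(5) by (intro \<phi>_eq) auto
          then show "w \<in> ?A" unfolding wv Z using v y' by auto
        qed
        ultimately show "\<exists>B. openin ?Z B \<and> z \<in> B \<and> B \<subseteq> ?A" by blast
      qed
    qed
    fix x assume x: "x \<in> topspace X"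
    \<comment> \<open>In \<open>N1 \<inter> N2\<close> any two points are close; in \<open>M1 \<inter> M2\<close> the translation between their
      images lies in \<open>U\<close>.\<close>
    obtain N1 N2 where N: "openin X N1" "openin X N2" "x \<in> N1" "x \<in> N2" "N1 \<times> N2 \<subseteq> E"
      using E x unfolding openin_prod_topology_alt by meson
    let ?XX = "prod_topology X X"
    let ?P = "{z \<in> topspace ?XX. inv (p (fst z)) \<otimes> p (snd z) \<in> U}"
    have "continuous_map ?XX T (\<lambda>z. inv (p (fst z)) \<otimes> p (snd z))"
      using continuous_map_compose[OF continuous_map_snd continuous_p, of X]
        continuous_map_inverse[OF continuous_map_compose[OF continuous_map_fst continuous_p, of X]]
      by (intro continuous_map_mult) (auto simp: o_def)
    then have "openin ?XX ?P" using U(1) by (rule openin_continuous_map_preimage)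
    moreover have "(x, x) \<in> ?P" using x U(2) by simp
    ultimately obtain M1 M2 where M: "openin X M1" "openin X M2" "x \<in> M1" "x \<in> M2" "M1 \<times> M2 \<subseteq> ?P"
      unfolding openin_prod_topology_alt by meson
    let ?N = "(N1 \<inter> N2) \<inter> (M1 \<inter> M2)"
    have "openin X ?N" using M N by blast
    moreover have "inv (p y) \<otimes> p z \<in> U \<and> \<phi> (inv (p y) \<otimes> p z) y = z" if "y \<in> ?N" "z \<in> ?N" for y z
    proof -
      have E': "(y, z) \<in> E" using that N(5) by blast
      have "(y, z) \<in> ?P" using that M(5) by blast
      then have U': "inv (p y) \<otimes> p z \<in> U" by simp
      have "p z = p y \<otimes> (inv (p y) \<otimes> p z)"
        using EX[OF E'] by (simp add: inv_solve_left m_assoc[symmetric])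
      then show ?thesis using \<phi>_eq[OF E' U'] U' by blast
    qed
    ultimately show "\<exists>N. openin X N \<and> x \<in> N \<and>
       (\<forall>y\<in>N. \<forall>z\<in>N. inv (p y) \<otimes> p z \<in> U \<and> \<phi> (inv (p y) \<otimes> p z) y = z)"
      using M N by (intro exI[of _ ?N]) blast
  qed
qed

section \<open>The lifts of right translations act simply transitively\<close>

definition translation_lift :: "('c \<Rightarrow> 'c) \<Rightarrow> bool" where
  "translation_lift f \<longleftrightarrow>
     continuous_map X X f \<and> (\<exists>a\<in>carrier G. \<forall>x\<in>topspace X. p (f x) = p x \<otimes> a)"

lemma translation_lift_closed: "\<lbrakk>translation_lift f; x \<in> topspace X\<rbrakk> \<Longrightarrow> f x \<in> topspace X"
  by (auto simp: translation_lift_def continuous_map_def)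

lemma translation_lift_id: "translation_lift (\<lambda>x. x)"
  by (auto simp: translation_lift_def intro!: bexI[of _ \<one>])

lemma translation_lift_comp:
  assumes "translation_lift f" "translation_lift g"
  shows "translation_lift (\<lambda>x. g (f x))"
proof -
  obtain a b where a: "a \<in> carrier G" "\<And>x. x \<in> topspace X \<Longrightarrow> p (f x) = p x \<otimes> a"
    and b: "b \<in> carrier G" "\<And>x. x \<in> topspace X \<Longrightarrow> p (g x) = p x \<otimes> b"
    using assms by (auto simp: translation_lift_def)
  have "continuous_map X X (\<lambda>x. g (f x))"
    using assms continuous_map_compose[of X X f X g] by (simp add: translation_lift_def o_def)
  moreover have "p (g (f x)) = p x \<otimes> (a \<otimes> b)" if "x \<in> topspace X" for x
    using a b that translation_lift_closed[OF assms(1)] by (simp add: m_assoc)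
  ultimately show ?thesis using a b by (auto simp: translation_lift_def)
qed

text \<open>Evaluating at \<open>y\<close> shows that both maps cover the same translation, so unique lifting applies.\<close>

lemma translation_lift_unique:
  assumes f: "translation_lift f" and g: "translation_lift g"
    and y: "y \<in> topspace X" "f y = g y" and x: "x \<in> topspace X"
  shows "f x = g x"
proof (rule lifts_agree[where f = f and g = g, OF connected_X Hausdorff_X locally_injective_p _ _ _ y x])
  show "continuous_map X X f" "continuous_map X X g" using f g by (auto simp: translation_lift_def)
  obtain a b where a: "a \<in> carrier G" "\<And>x. x \<in> topspace X \<Longrightarrow> p (f x) = p x \<otimes> a"
    and b: "b \<in> carrier G" "\<And>x. x \<in> topspace X \<Longrightarrow> p (g x) = p x \<otimes> b"
    using f g by (auto simp: translation_lift_def)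
  have "p y \<otimes> a = p y \<otimes> b" using a b y by metis
  then have "a = b" using a b y by simp
  then show "p (f z) = p (g z)" if "z \<in> topspace X" for z using a b that by simp
qed

lemma local_translation_lift:
  assumes "openin T U" "u \<in> U"
    and "continuous_map (prod_topology (subtopology T U) X) X (\<lambda>(u, x). \<phi> u x)"
    and "\<And>x. x \<in> topspace X \<Longrightarrow> p (\<phi> u x) = p x \<otimes> u"
  shows "translation_lift (\<phi> u)"
proof -
  have u: "u \<in> topspace T" using assms openin_subset by blast
  have "continuous_map X (prod_topology (subtopology T U) X) (\<lambda>x. (u, x))"
    using u assms by (intro continuous_map_pairedI) (auto simp: continuous_map_in_subtopology)
  from continuous_map_compose[OF this assms(3)] show ?thesis
    using u assms carrier_eq_topspace by (auto simp: translation_lift_def o_def)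
qed

text \<open>Reachability by translation lifts is constant on the neighbourhoods provided by the local
  action, so the points reachable from \<open>x\<close> form an open and closed set.\<close>

lemma translation_lifts_transitive:
  assumes x: "x \<in> topspace X" and y: "y \<in> topspace X"
  shows "\<exists>f. translation_lift f \<and> f x = y"
proof -
  obtain U \<phi> where U: "openin T U"
    and cont: "continuous_map (prod_topology (subtopology T U) X) X (\<lambda>(u, x). \<phi> u x)"
    and p: "\<And>u x. \<lbrakk>u \<in> U; x \<in> topspace X\<rbrakk> \<Longrightarrow> p (\<phi> u x) = p x \<otimes> u"
    and near: "\<And>x. x \<in> topspace X \<Longrightarrow> \<exists>N. openin X N \<and> x \<in> N \<and>
       (\<forall>y\<in>N. \<forall>z\<in>N. inv (p y) \<otimes> p z \<in> U \<and> \<phi> (inv (p y) \<otimes> p z) y = z)"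
    using local_translation_action by blast
  define R where "R = {y \<in> topspace X. \<exists>f. translation_lift f \<and> f x = y}"
  have orbit: "\<exists>N. openin X N \<and> w \<in> N \<and> (N \<subseteq> R \<or> N \<inter> R = {})" if w: "w \<in> topspace X" for w
  proof -
    obtain N where N: "openin X N" "w \<in> N"
      and step: "\<And>y z. y \<in> N \<Longrightarrow> z \<in> N \<Longrightarrow> inv (p y) \<otimes> p z \<in> U \<and> \<phi> (inv (p y) \<otimes> p z) y = z"
      using near[OF w] by blast
    have "z \<in> R" if yz: "y \<in> N" "z \<in> N" "y \<in> R" for y z
    proof -
      obtain f where f: "translation_lift f" "f x = y" using yz(3) by (auto simp: R_def)
      have g: "translation_lift (\<phi> (inv (p y) \<otimes> p z))" "\<phi> (inv (p y) \<otimes> p z) y = z"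
        using step[OF yz(1,2)] local_translation_lift[where \<phi> = \<phi>, OF U _ cont] p by auto
      have "z \<in> topspace X" using openin_subset[OF N(1)] yz(2) by blast
      then show ?thesis
        unfolding R_def using translation_lift_comp[OF f(1) g(1)] f(2) g(2) by blast
    qed
    then show ?thesis using N by blast
  qed
  have "openin X R"
    unfolding openin_subopen[of X R]
  proof
    fix w assume w: "w \<in> R"
    then obtain N where "openin X N" "w \<in> N" "N \<subseteq> R \<or> N \<inter> R = {}"
      using orbit[of w] by (auto simp: R_def)
    then show "\<exists>N. openin X N \<and> w \<in> N \<and> N \<subseteq> R" using w by blast
  qed
  moreover have "openin X (topspace X - R)"
    unfolding openin_subopen[of X "topspace X - R"]
  proof
    fix w assume w: "w \<in> topspace X - R"
    then obtain N where N: "openin X N" "w \<in> N" "N \<subseteq> R \<or> N \<inter> R = {}"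
      using orbit[of w] by auto
    then have "N \<subseteq> topspace X - R" using w openin_subset[OF N(1)] by blast
    then show "\<exists>N. openin X N \<and> w \<in> N \<and> N \<subseteq> topspace X - R" using N(1,2) by blast
  qed
  moreover have "R \<subseteq> topspace X" by (auto simp: R_def)
  ultimately have "R = {} \<or> R = topspace X"
    using connected_X by (simp add: connected_space_clopen_in closedin_def)
  moreover have "x \<in> R" using x translation_lift_id by (auto simp: R_def)
  ultimately have "y \<in> R" using y by blast
  then show ?thesis by (simp add: R_def)
qed

section \<open>The group structure on the covering space\<close>

definition lift_to :: "'c \<Rightarrow> 'c \<Rightarrow> 'c" where
  "lift_to y = (SOME f. translation_lift f \<and> f e = y)"

lemma lift_to:
  assumes "y \<in> topspace X"
  shows "translation_lift (lift_to y)" "lift_to y e = y"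
  using someI_ex[OF translation_lifts_transitive[OF e_in assms]] by (auto simp: lift_to_def)

text \<open>Applied to a composite of two translation lifts, this becomes associativity of the product.\<close>

lemma lift_to_eq:
  assumes "translation_lift f" "x \<in> topspace X"
  shows "lift_to (f e) x = f x"
  using assms translation_lift_unique[OF _ assms(1) e_in] lift_to translation_lift_closed e_in
  by blast

lemma lift_to_closed: "\<lbrakk>x \<in> topspace X; y \<in> topspace X\<rbrakk> \<Longrightarrow> lift_to y x \<in> topspace X"
  using lift_to translation_lift_closed by blast

lemma p_lift_to:
  assumes x: "x \<in> topspace X" and y: "y \<in> topspace X"
  shows "p (lift_to y x) = p x \<otimes> p y"
proof -
  obtain a where a: "a \<in> carrier G" "\<And>x. x \<in> topspace X \<Longrightarrow> p (lift_to y x) = p x \<otimes> a"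
    using lift_to(1)[OF y] by (auto simp: translation_lift_def)
  then have "p y = a" using a(2)[OF e_in] lift_to(2)[OF y] p_e by simp
  then show ?thesis using a x by simp
qed

lemma lift_to_lift_to:
  assumes "x \<in> topspace X" "y \<in> topspace X" "z \<in> topspace X"
  shows "lift_to z (lift_to y x) = lift_to (lift_to z y) x"
  using lift_to_eq[OF translation_lift_comp[OF lift_to(1) lift_to(1)], of y z x] assms lift_to(2)
  by simp

text \<open>The product \<open>x \<otimes> y\<close> is \<open>lift_to y x\<close>, with the factors in this order, because \<open>lift_to y\<close> is to be
  the right translation by \<open>y\<close>.\<close>

definition cover_group :: "'c monoid" where
  "cover_group = \<lparr>carrier = topspace X, monoid.mult = (\<lambda>x y. lift_to y x), one = e\<rparr>"

lemma cover_group_simps [simp]: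
  "carrier cover_group = topspace X"
  "x \<otimes>\<^bsub>cover_group\<^esub> y = lift_to y x"
  "\<one>\<^bsub>cover_group\<^esub> = e"
  by (simp_all add: cover_group_def)

text \<open>For inverses, let \<open>g\<close> be a translation lift with \<open>g x = e\<close>.  Then \<open>lift_to x \<circ> g\<close> fixes \<open>x\<close>, hence is
  the identity, and \<open>g e\<close> is a left inverse of \<open>x\<close>.\<close>

lemma group_cover_group: "group cover_group"
proof (rule groupI)
  fix x assume "x \<in> carrier cover_group"
  then have x: "x \<in> topspace X" by simp
  show "\<one>\<^bsub>cover_group\<^esub> \<otimes>\<^bsub>cover_group\<^esub> x = x" using lift_to x by simp
  obtain g where g: "translation_lift g" "g x = e" using translation_lifts_transitive[OF x e_in] by blast
  have "lift_to x (g x) = x" using g lift_to x by simp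
  then have "lift_to x (g e) = e"
    using translation_lift_unique[OF translation_lift_comp[OF g(1) lift_to(1)[OF x]]
        translation_lift_id x _ e_in] by simp
  then show "\<exists>y\<in>carrier cover_group. y \<otimes>\<^bsub>cover_group\<^esub> x = \<one>\<^bsub>cover_group\<^esub>"
    using translation_lift_closed[OF g(1) e_in] by auto
qed (use e_in lift_to_closed lift_to_lift_to in auto)

text \<open>Near \<open>y0\<close> the right translations depend on \<open>y\<close> only through the local action: \<open>lift_to y\<close> is
  \<open>\<phi> (inv (p y0) \<otimes> p y)\<close> after \<open>lift_to y0\<close> and, symmetrically, \<open>lift_to y0\<close> is
  \<open>\<phi> (inv (p y) \<otimes> p y0)\<close> after \<open>lift_to y\<close>.  The first formula gives joint continuity of the product.
  The second, evaluated at the inverse of \<open>y\<close>, expresses \<open>y\<inverse> y0\<close> as \<open>\<phi> (inv (p y) \<otimes> p y0) e\<close>,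
  and \<open>y\<inverse> = (y\<inverse> y0) y0\<inverse>\<close> is then continuous in \<open>y\<close>.\<close>

lemma topological_group_cover_group: "topological_group cover_group X"
proof -
  interpret H: group cover_group by (rule group_cover_group)
  obtain U \<phi> where U: "openin T U"
    and cont: "continuous_map (prod_topology (subtopology T U) X) X (\<lambda>(u, x). \<phi> u x)"
    and p: "\<And>u x. \<lbrakk>u \<in> U; x \<in> topspace X\<rbrakk> \<Longrightarrow> p (\<phi> u x) = p x \<otimes> u"
    and near: "\<And>x. x \<in> topspace X \<Longrightarrow> \<exists>N. openin X N \<and> x \<in> N \<and>
       (\<forall>y\<in>N. \<forall>z\<in>N. inv (p y) \<otimes> p z \<in> U \<and> \<phi> (inv (p y) \<otimes> p z) y = z)"
    using local_translation_action by blast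
  have \<phi>_comp: "continuous_map Z X (\<lambda>z. \<phi> (f z) (g z))"
    if "continuous_map Z T f" "\<And>z. z \<in> topspace Z \<Longrightarrow> f z \<in> U" "continuous_map Z X g" for Z f g
    using continuous_map_compose[OF continuous_map_pairedI[OF
        continuous_map_into_subtopology[of _ _ _ U] that(3)] cont, of f] that(1,2)
    by (auto simp: o_def)
  have \<phi>_lift: "translation_lift (\<phi> u)" if "u \<in> U" for u
    using local_translation_lift[where \<phi> = \<phi>, OF U that cont] p that by blast
  have step: "lift_to z x = \<phi> (inv (p y) \<otimes> p z) (lift_to y x)"
    if "inv (p y) \<otimes> p z \<in> U" "\<phi> (inv (p y) \<otimes> p z) y = z" "x \<in> topspace X" "y \<in> topspace X" for x y z
    using lift_to_eq[OF translation_lift_comp[OF lift_to(1) \<phi>_lift]] lift_to(2) that by metis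
  show ?thesis
  proof
    show "carrier cover_group = topspace X" by simp
    let ?XX = "prod_topology X X"
    show "continuous_map ?XX X (\<lambda>(x, y). x \<otimes>\<^bsub>cover_group\<^esub> y)"
    proof (rule continuous_map_locally)
      fix w assume "w \<in> topspace ?XX"
      then obtain x0 y0 where w: "w = (x0, y0)" "x0 \<in> topspace X" "y0 \<in> topspace X" by auto
      obtain N where N: "openin X N" "y0 \<in> N"
        and nearN: "\<And>y z. y \<in> N \<Longrightarrow> z \<in> N \<Longrightarrow> inv (p y) \<otimes> p z \<in> U \<and> \<phi> (inv (p y) \<otimes> p z) y = z"
        using near[OF w(3)] by blast
      let ?M = "{w \<in> topspace ?XX. snd w \<in> N}"
      let ?Z = "subtopology ?XX ?M"
      have fst: "continuous_map ?Z X fst" and snd: "continuous_map ?Z X snd"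
        by (auto intro: continuous_map_from_subtopology continuous_map_fst continuous_map_snd)
      have "openin ?XX ?M" by (rule openin_continuous_map_preimage[OF continuous_map_snd N(1)])
      moreover have "w \<in> ?M" using w N by auto
      moreover have "continuous_map ?Z X (\<lambda>w. \<phi> (inv (p y0) \<otimes> p (snd w)) (lift_to y0 (fst w)))"
      proof (rule \<phi>_comp)
        show "continuous_map ?Z T (\<lambda>w. inv (p y0) \<otimes> p (snd w))"
          using continuous_map_compose[OF snd continuous_p] w(3) carrier_eq_topspace[symmetric]
          by (intro continuous_map_mult) (auto simp: o_def)
        show "inv (p y0) \<otimes> p (snd w) \<in> U" if "w \<in> topspace ?Z" for w
          using that nearN N(2) by auto
        show "continuous_map ?Z X (\<lambda>w. lift_to y0 (fst w))"
          using continuous_map_compose[OF fst, of X "lift_to y0"] lift_to(1)[OF w(3)]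
          by (auto simp: o_def translation_lift_def)
      qed
      then have "continuous_map ?Z X (\<lambda>(x, y). x \<otimes>\<^bsub>cover_group\<^esub> y)"
      proof (rule continuous_map_eq)
        fix v assume "v \<in> topspace ?Z"
        then obtain x y where v: "v = (x, y)" "x \<in> topspace X" "y \<in> N" by auto
        show "\<phi> (inv (p y0) \<otimes> p (snd v)) (lift_to y0 (fst v)) = (case v of (x, y) \<Rightarrow> x \<otimes>\<^bsub>cover_group\<^esub> y)"
          using step[of y0 y x] nearN[OF N(2) v(3)] v w(3) by simp
      qed
      ultimately show "\<exists>M. openin ?XX M \<and> w \<in> M \<and>
          continuous_map (subtopology ?XX M) X (\<lambda>(x, y). x \<otimes>\<^bsub>cover_group\<^esub> y)"
        by blast
    qed
    show "continuous_map X X (\<lambda>x. inv\<^bsub>cover_group\<^esub> x)"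
    proof (rule continuous_map_locally)
      fix y0 assume y0: "y0 \<in> topspace X"
      obtain N where N: "openin X N" "y0 \<in> N"
        and nearN: "\<And>y z. y \<in> N \<Longrightarrow> z \<in> N \<Longrightarrow> inv (p y) \<otimes> p z \<in> U \<and> \<phi> (inv (p y) \<otimes> p z) y = z"
        using near[OF y0] by blast
      let ?i = "\<lambda>y. inv\<^bsub>cover_group\<^esub> y"
      let ?Z = "subtopology X N"
      have iX: "?i y \<in> topspace X" if "y \<in> topspace X" for y using H.inv_closed that by simp
      have "continuous_map ?Z X (\<lambda>y. lift_to (?i y0) (\<phi> (inv (p y) \<otimes> p y0) e))"
      proof -
        have "continuous_map ?Z X (\<lambda>y. \<phi> (inv (p y) \<otimes> p y0) e)"
        proof (rule \<phi>_comp)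
          show "continuous_map ?Z T (\<lambda>y. inv (p y) \<otimes> p y0)"
            using continuous_map_inverse[OF continuous_map_from_subtopology[OF continuous_p]]
              y0 carrier_eq_topspace[symmetric]
            by (intro continuous_map_mult) auto
          show "inv (p y) \<otimes> p y0 \<in> U" if "y \<in> topspace ?Z" for y
            using that nearN N(2) by auto
        qed (use e_in in auto)
        from continuous_map_compose[OF this, of X "lift_to (?i y0)"] show ?thesis
          using lift_to(1)[OF iX[OF y0]] by (auto simp: o_def translation_lift_def)
      qed
      then have "continuous_map ?Z X ?i"
      proof (rule continuous_map_eq)
        fix y assume "y \<in> topspace ?Z"
        then have y: "y \<in> topspace X" "y \<in> N" by auto
        have "\<phi> (inv (p y) \<otimes> p y0) e = \<phi> (inv (p y) \<otimes> p y0) (lift_to y (?i y))"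
          using H.l_inv[of y] y by simp
        also have "\<dots> = lift_to y0 (?i y)"
          using step[of y y0 "?i y"] nearN[OF y(2) N(2)] iX y by simp
        finally have "lift_to (?i y0) (\<phi> (inv (p y) \<otimes> p y0) e) =
            (?i y \<otimes>\<^bsub>cover_group\<^esub> y0) \<otimes>\<^bsub>cover_group\<^esub> ?i y0" by simp
        also have "\<dots> = ?i y"
          using H.m_assoc[of "?i y" y0 "?i y0"] H.r_inv[of y0] H.r_one[of "?i y"] iX y y0 
          by (metis cover_group_simps(1))
        finally show "lift_to (?i y0) (\<phi> (inv (p y) \<otimes> p y0) e) = ?i y" .
      qed
      then show "\<exists>N. openin X N \<and> y0 \<in> N \<and> continuous_map (subtopology X N) X ?i"
        using N by blast
    qed
  qed
qed

lemma p_hom_cover_group: "p \<in> hom cover_group G"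
  using p_lift_to by (auto simp: hom_def)

text \<open>Unique lifting on \<open>X \<times> X\<close>; it yields both the uniqueness of the group structure and, by
  comparing the multiplication with its opposite, commutativity.\<close>

lemma lifted_multiplications_agree:
  assumes m: "continuous_map (prod_topology X X) X (\<lambda>(x, y). m x y)"
    and n: "continuous_map (prod_topology X X) X (\<lambda>(x, y). n x y)"
    and same: "\<And>x y. \<lbrakk>x \<in> topspace X; y \<in> topspace X\<rbrakk> \<Longrightarrow> p (m x y) = p (n x y)"
    and base: "m e e = n e e" and x: "x \<in> topspace X" and y: "y \<in> topspace X"
  shows "m x y = n x y"
proof -
  have "connected_space (prod_topology X X)"
    using connected_X by (simp add: connected_space_prod_topology)
  from lifts_agree[OF this Hausdorff_X locally_injective_p m n, of "(e, e)" "(x, y)"]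
  show ?thesis using same base x y e_in by auto
qed

lemma cover_group_unique:
  assumes K: "topological_group K X" and one: "\<one>\<^bsub>K\<^esub> = e" and hom: "p \<in> hom K G"
  shows "same_group_structure cover_group K"
proof -
  interpret K: topological_group K X by (rule K)
  interpret H: topological_group cover_group X by (rule topological_group_cover_group)
  have "x \<otimes>\<^bsub>cover_group\<^esub> y = x \<otimes>\<^bsub>K\<^esub> y" if "x \<in> topspace X" "y \<in> topspace X" for x y
  proof (rule lifted_multiplications_agree[OF H.continuous_mult K.continuous_mult _ _ that])
    show "e \<otimes>\<^bsub>cover_group\<^esub> e = e \<otimes>\<^bsub>K\<^esub> e"
      using H.r_one[of e] K.r_one[of e] e_in K.carrier_eq_topspace one by simp
    show "p (x \<otimes>\<^bsub>cover_group\<^esub> y) = p (x \<otimes>\<^bsub>K\<^esub> y)" if "x \<in> topspace X" "y \<in> topspace X" for x y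
      using p_lift_to[OF that] hom that K.carrier_eq_topspace by (simp add: hom_def)
  qed
  then show ?thesis using one K.carrier_eq_topspace by (simp add: same_group_structure_def)
qed

lemma comm_group_cover_group:
  assumes "comm_group G"
  shows "comm_group cover_group"
proof -
  interpret G: comm_group G by fact
  interpret H: topological_group cover_group X by (rule topological_group_cover_group)
  show ?thesis
  proof (rule H.group_comm_groupI)
    fix x y assume "x \<in> carrier cover_group" "y \<in> carrier cover_group"
    then have xy: "x \<in> topspace X" "y \<in> topspace X" by auto
    have "continuous_map (prod_topology X X) X (\<lambda>(x, y). y \<otimes>\<^bsub>cover_group\<^esub> x)"
      using H.continuous_map_mult[OF continuous_map_snd continuous_map_fst]
      by (simp add: case_prod_unfold)
    then show "x \<otimes>\<^bsub>cover_group\<^esub> y = y \<otimes>\<^bsub>cover_group\<^esub> x"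
      by (rule lifted_multiplications_agree[OF H.continuous_mult _ _ _ xy])
        (auto simp: p_lift_to G.m_comm)
  qed
qed

end

theorem theorem1:
  fixes X :: "'a topology" and T :: "'b topology" and G :: "'b monoid"
    and p :: "'a \<Rightarrow> 'b" and e' :: 'a
  assumes "connected_space X" and "Hausdorff_space X"
    and "compact_group G T"
    and "finite_sheeted_covering_map X T p"
    and "e' \<in> topspace X" and "p e' = \<one>\<^bsub>G\<^esub>"
  shows "\<exists>H :: 'a monoid.
           topological_group H X \<and> \<one>\<^bsub>H\<^esub> = e' \<and> compact_group_hom H X G T p \<and>
           (\<forall>K :: 'a monoid.
              topological_group K X \<and> \<one>\<^bsub>K\<^esub> = e' \<and> p \<in> hom K G \<longrightarrow>
              same_group_structure H K) \<and>
           (comm_group G \<longrightarrow> comm_group H)"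
proof -
  interpret G: compact_group G T by fact
  obtain k where cov: "sheeted_covering_map k X T p"
    using assms(4) by (auto simp: finite_sheeted_covering_map_def)
  interpret C: local_cover_of_compact_group G T X p e'
  proof
    show "compact_space X" by (rule sheeted_covering_compact_space[OF cov G.compact])
    show "continuous_map X T p" using cov by (simp add: sheeted_covering_map_def)
    show "open_map X T p" by (rule sheeted_covering_imp_open_map[OF cov])
    show "locally_injective_map X p" by (rule sheeted_covering_imp_locally_injective[OF cov])
  qed (use assms in auto)
  interpret H: topological_group C.cover_group X by (rule C.topological_group_cover_group)
  have "compact_group_hom C.cover_group X G T p"
    by unfold_locales
      (use C.compact_X C.Hausdorff_X C.p_hom_cover_group C.continuous_p in auto)
  then show ?thesis
    using C.topological_group_cover_group C.cover_group_unique C.comm_group_cover_group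
    by (intro exI[of _ C.cover_group]) auto
qed

end
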